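(* The conjecture that every c\`adl\`ag function $p$ is identified by the ratio $H_{n,m}(p,\cdot)$ for any distinct positive integers $n,m$ is false. In fact, for all co-prime integers $n>m\ge 1$, the functions $p(t)=\sin t$ and $q(t)=\sin t\,\mathbf{1}_{[0,2\pi]}(t)$, $t\ge 0$, are c\`adl\`ag functions of exponential order with $\inf\{x>0:p(x)\ne 0\}=\inf\{x>0:q(x)\neq 0\}=0$, $p\neq q$, and $H_{n,m}(p,\cdot)=H_{n,m}(q,\cdot)$.
   Context: A function $p:[0,\infty)\to\mathbb{R}$ is of exponential order if there exist $c>0$, $C>0$ with $|p(x)|\le Ce^{cx}$ for all $x\ge 0$; its Laplace transform is $\widehat p(\lambda)=\int_0^\infty e^{-\lambda x}p(x)\,dx$ for $\lambda$ with real part larger than $c$. For positive integers $n,m$, $H_{n,m}(p,\lambda):=\widehat{p^n}(\lambda)/\widehat{p^m}(\lambda)$, where $p^k$ is the pointwise $k$-th power. The equality $H_{n,m}(p,\cdot)=H_{n,m}(q,\cdot)$ means $H_{n,m}(p,\lambda)=H_{n,m}(q,\lambda)$ for all sufficiently large $\lambda$. C\`adl\`ag means right continuous with left limits. A function $p$ is identified by the ratio if $H_{n,m}(p,\cdot)=H_{n,m}(q,\cdot)$ implies $p=q$ for $q$ in the class considered. Functions are only considered if they satisfy $\inf\{x>0:p(x)\neq0\}=0$. $\mathbf{1}_A$ is the indicator function of $A$. *)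

theory Defs
  imports "HOL-Analysis.Analysis"
begin

text \<open>Functions on the half-line \<open>[0, \<infinity>)\<close> are modelled by functions of type
  \<^typ>\<open>real \<Rightarrow> real\<close> whose values at negative arguments are never inspected.\<close>

definition exponential_order :: "(real \<Rightarrow> real) \<Rightarrow> bool" where
  "exponential_order p \<longleftrightarrow> (\<exists>c>0. \<exists>C>0. \<forall>x\<ge>0. \<bar>p x\<bar> \<le> C * exp (c * x))"

definition cadlag :: "(real \<Rightarrow> real) \<Rightarrow> bool" where
  "cadlag p \<longleftrightarrow> (\<forall>t\<ge>0. continuous (at_right t) p) \<and> (\<forall>t>0. \<exists>l. (p \<longlongrightarrow> l) (at_left t))"

text \<open>The infimum is taken in the extended reals, so that the empty set has infimum \<open>\<infinity>\<close>;
  in \<^typ>\<open>real\<close> the infimum of the empty set is an unspecified number.\<close>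

definition inf_support :: "(real \<Rightarrow> real) \<Rightarrow> ereal" where
  "inf_support p = Inf (ereal ` {x. 0 < x \<and> p x \<noteq> 0})"

definition laplace :: "(real \<Rightarrow> real) \<Rightarrow> complex \<Rightarrow> complex" where
  "laplace p l = (LINT x:{0..}|lborel. exp (- l * of_real x) * of_real (p x))"

definition H :: "nat \<Rightarrow> nat \<Rightarrow> (real \<Rightarrow> real) \<Rightarrow> complex \<Rightarrow> complex" where
  "H n m p l = laplace (\<lambda>x. p x ^ n) l / laplace (\<lambda>x. p x ^ m) l"

text \<open>Division by zero yields zero in HOL, so it is required explicitly that both ratios be
  defined for all large \<open>\<lambda>\<close>. \<open>Large\<close> refers to real \<open>\<lambda>\<close>.\<close>

definition H_equal :: "nat \<Rightarrow> nat \<Rightarrow> (real \<Rightarrow> real) \<Rightarrow> (real \<Rightarrow> real) \<Rightarrow> bool" where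
  "H_equal n m p q \<longleftrightarrow> (\<forall>\<^sub>F l in at_top.
     laplace (\<lambda>x. p x ^ m) (complex_of_real l) \<noteq> 0 \<and>
     laplace (\<lambda>x. q x ^ m) (complex_of_real l) \<noteq> 0 \<and>
     H n m p (complex_of_real l) = H n m q (complex_of_real l))"

definition cadlag_class :: "(real \<Rightarrow> real) set" where
  "cadlag_class = {p. cadlag p \<and> exponential_order p \<and> inf_support p = 0}"

definition identified_by_ratio ::
    "(real \<Rightarrow> real) set \<Rightarrow> nat \<Rightarrow> nat \<Rightarrow> (real \<Rightarrow> real) \<Rightarrow> bool" where
  "identified_by_ratio F n m p \<longleftrightarrow> (\<forall>q\<in>F. H_equal n m p q \<longrightarrow> (\<forall>t\<ge>0. p t = q t))"

end

theory Submission
  imports Defs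
begin

text \<open>If \<open>f\<close> is multiplied by the constant \<open>s\<close> under a shift of the argument by \<open>T\<close>, then cutting the
  Laplace integral at \<open>T\<close> and shifting the tail back gives
  \<open>(1 - s exp (- \<lambda> T)) * laplace f \<lambda> = laplace (f restricted to [0, T]) \<lambda>\<close>
  (\<open>laplace_shift_scale\<close>). All powers of the sine have the common period \<open>2 * pi\<close>. Hence restricting
  to \<open>[0, 2 * pi]\<close> multiplies the transform of every positive power by the same factor
  \<open>1 - exp (- 2 * pi * \<lambda>)\<close>, which cancels in the ratio; the sine and its restriction to one period
  are therefore indistinguishable by ratios, although they differ after \<open>2 * pi\<close>.

  What remains is that the ratios are defined. The same formula with \<open>T = pi\<close> and \<open>s = (- 1) ^ m\<close>
  reduces the denominator to the transform of \<open>sin x ^ m\<close> on \<open>[0, pi]\<close>, where the integrand is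
  positive in the interior (\<open>laplace_sin_power_nonzero\<close>). The half period is used because over a
  whole period the integrand changes sign when \<open>m\<close> is odd.\<close>

section \<open>Laplace transforms of quasi-periodic functions\<close>

lemma laplace_integrand_integrable:
  fixes f :: "real \<Rightarrow> real" and l :: complex
  assumes [measurable]: "f \<in> borel_measurable borel"
    and bnd: "\<And>x. \<bar>f x\<bar> \<le> B" and l: "0 < Re l"
  shows "set_integrable lborel {0..} (\<lambda>x. exp (- l * of_real x) * of_real (f x))"
proof -
  have "(\<lambda>x. exp (- Re l * x)) absolutely_integrable_on {0..}"
    using integrable_on_exp_minus_to_infinity[OF l, of 0]
    by (rule nonnegative_absolutely_integrable_1) simp
  then have e: "set_integrable lborel {0..} (\<lambda>x. exp (- (x * Re l)))"
    unfolding set_integrable_def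
    by (subst (asm) integrable_completion) (auto simp: mult.commute)
  have "set_integrable lborel {0..} (\<lambda>x. B * exp (- (x * Re l)))"
    using e by simp
  then show ?thesis
    unfolding set_integrable_def
  proof (rule Bochner_Integration.integrable_bound)
    show "AE x in lborel. norm (indicat_real {0..} x *\<^sub>R (exp (- l * of_real x) * of_real (f x)))
        \<le> norm (indicat_real {0..} x *\<^sub>R (B * exp (- (x * Re l))))"
    proof (rule AE_I2)
      fix x
      have "B \<ge> 0" using bnd[of 0] by linarith
      then show "norm (indicat_real {0..} x *\<^sub>R (exp (- l * of_real x) * of_real (f x)))
        \<le> norm (indicat_real {0..} x *\<^sub>R (B * exp (- (x * Re l))))"
        using bnd[of x]
        by (auto simp: norm_mult norm_exp_eq_Re abs_mult mult.commute split: split_indicator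
            intro!: mult_right_mono)
    qed
  qed measurable
qed

text \<open>The factor \<open>s\<close> covers both the full period of the sine powers (\<open>s = 1\<close>) and the half period,
  where the sign depends on the parity of the exponent.\<close>

lemma laplace_shift_scale:
  fixes f :: "real \<Rightarrow> real" and l :: complex and s T :: real
  assumes meas [measurable]: "f \<in> borel_measurable borel"
    and bnd: "\<And>x. \<bar>f x\<bar> \<le> B" and l: "0 < Re l" and T: "0 \<le> T"
    and shift: "\<And>x. f (x + T) = s * f x"
  shows "laplace f l * (1 - of_real s * exp (- l * of_real T))
    = laplace (\<lambda>x. f x * indicator {0..T} x) l"
proof -
  define g where "g = (\<lambda>x. exp (- l * of_real x) * (of_real (f x) :: complex))"
  have g_int: "set_integrable lborel {0..} g"
    unfolding g_def by (rule laplace_integrand_integrable[OF meas bnd l])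
  have g_shift: "g (x + T) = of_real s * exp (- l * of_real T) * g x" for x
  proof -
    have "- l * of_real (x + T) = - l * of_real T + - l * of_real x"
      by (simp add: algebra_simps)
    then have "exp (- l * of_real (x + T)) = exp (- l * of_real T) * exp (- l * of_real x)"
      by (simp only: exp_add)
    then show ?thesis
      by (simp add: g_def shift del: of_real_add)
  qed
  have "(LINT x:{T<..}|lborel. g x) = (LINT x:{0<..}|lborel. g (x + T))"
    unfolding set_lebesgue_integral_def
    by (subst lborel_integral_real_affine[where c=1 and t=T])
      (auto intro!: Bochner_Integration.integral_cong simp: add.commute split: split_indicator)
  also have "\<dots> = of_real s * exp (- l * of_real T) * (LINT x:{0<..}|lborel. g x)"
    by (simp add: g_shift)
  also have "(LINT x:{0<..}|lborel. g x) = (LINT x:{0..}|lborel. g x)"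
    unfolding set_lebesgue_integral_def
    using AE_lborel_singleton[of "0::real"]
    by (intro integral_cong_AE) (auto simp: g_def split: split_indicator)
  finally have tail: "(LINT x:{T<..}|lborel. g x)
      = of_real s * exp (- l * of_real T) * laplace f l"
    by (simp add: laplace_def g_def)
  have "laplace f l = (LINT x:{0..T} \<union> {T<..}|lborel. g x)"
    using T by (simp add: laplace_def g_def ivl_disj_un)
  also have "\<dots> = (LINT x:{0..T}|lborel. g x) + (LINT x:{T<..}|lborel. g x)"
    using T by (intro set_integral_Un set_integrable_subset[OF g_int]) auto
  also have "(LINT x:{0..T}|lborel. g x) = laplace (\<lambda>x. f x * indicator {0..T} x) l"
    unfolding laplace_def set_lebesgue_integral_def
    by (intro Bochner_Integration.integral_cong) (auto simp: g_def split: split_indicator)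
  finally have "laplace f l = laplace (\<lambda>x. f x * indicator {0..T} x) l
      + of_real s * exp (- l * of_real T) * laplace f l"
    unfolding tail .
  then have "laplace f l - of_real s * exp (- l * of_real T) * laplace f l
      = laplace (\<lambda>x. f x * indicator {0..T} x) l"
    by (simp only: diff_eq_eq)
  then show ?thesis
    by (simp only: right_diff_distrib mult_1_left mult_1_right mult.commute)
qed

text \<open>For real \<open>l\<close> the complex integral is the embedding of a real one with nonnegative integrand.
  It vanishes only if the integrand is zero almost everywhere, which positivity on an interval
  excludes.\<close>

lemma laplace_nonzero_of_nonneg:
  fixes f :: "real \<Rightarrow> real" and l :: real
  assumes meas [measurable]: "f \<in> borel_measurable borel"
    and bnd: "\<And>x. \<bar>f x\<bar> \<le> B" and l: "0 < l"
    and nonneg: "\<And>x. 0 \<le> x \<Longrightarrow> 0 \<le> f x"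
    and pos: "\<And>x. 0 < x \<Longrightarrow> x < T \<Longrightarrow> 0 < f x" and T: "0 < T"
  shows "laplace f (of_real l) \<noteq> 0"
proof
  define h where "h = (\<lambda>x. indicator {0..} x * (exp (- l * x) * f x))"
  assume "laplace f (of_real l) = 0"
  also have "laplace f (of_real l) = (LINT x|lborel. complex_of_real (h x))"
    unfolding laplace_def set_lebesgue_integral_def
    by (intro Bochner_Integration.integral_cong)
      (auto simp: h_def scaleR_conv_of_real simp flip: exp_of_real)
  finally have h0: "(LINT x|lborel. h x) = 0"
    by simp
  have "integrable lborel (\<lambda>x. complex_of_real (h x))"
    using laplace_integrand_integrable[OF meas bnd, of "of_real l"] l
    by (simp add: set_integrable_def h_def scaleR_conv_of_real flip: exp_of_real)
  then have "integrable lborel h"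
    by (simp add: complex_of_real_integrable_eq)
  then have "AE x in lborel. h x = 0"
    using h0 by (subst (asm) integral_nonneg_eq_0_iff_AE) (auto simp: h_def nonneg split: split_indicator)
  then have "AE x in lborel. x \<notin> {0<..<T}"
    by eventually_elim (use pos in \<open>force simp: h_def\<close>)
  then have "emeasure lborel {0<..<T} = 0"
    by (subst (asm) AE_iff_measurable[where N="{0<..<T}"]) auto
  then show False
    using T by simp
qed

section \<open>Powers of the sine\<close>

lemma laplace_sin_power_nonzero:
  fixes l :: real
  assumes l: "0 < l"
  shows "laplace (\<lambda>x. sin x ^ m) (of_real l) \<noteq> 0"
proof -
  have "laplace (\<lambda>x. sin x ^ m) (of_real l)
      * (1 - of_real ((- 1) ^ m) * exp (- of_real l * of_real pi))
    = laplace (\<lambda>x. sin x ^ m * indicator {0..pi} x) (of_real l)"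
    by (rule laplace_shift_scale[where B=1])
      (use l in \<open>auto simp: power_abs power_le_one power_minus[of "sin _"]\<close>)
  moreover have "laplace (\<lambda>x. sin x ^ m * indicator {0..pi} x) (of_real l) \<noteq> 0"
    by (rule laplace_nonzero_of_nonneg[where B=1 and T=pi])
      (use l in \<open>auto simp: power_abs power_le_one sin_gt_zero sin_ge_zero split: split_indicator\<close>)
  ultimately show ?thesis
    by auto
qed

lemma laplace_sin_one_period_power:
  fixes l :: real
  assumes l: "0 < l" and k: "1 \<le> k"
  shows "laplace (\<lambda>x. (sin x * indicator {0..2 * pi} x) ^ k) (of_real l)
    = laplace (\<lambda>x. sin x ^ k) (of_real l) * (1 - exp (- of_real l * of_real (2 * pi)))"
proof -
  have "laplace (\<lambda>x. sin x ^ k) (of_real l)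
      * (1 - of_real 1 * exp (- of_real l * of_real (2 * pi)))
    = laplace (\<lambda>x. sin x ^ k * indicator {0..2 * pi} x) (of_real l)"
    by (rule laplace_shift_scale[where B=1]) (use l in \<open>auto simp: power_abs power_le_one\<close>)
  moreover have "(\<lambda>x. (sin x * indicator {0..2 * pi} x) ^ k)
      = (\<lambda>x::real. sin x ^ k * indicator {0..2 * pi} x)"
    using k by (auto simp: fun_eq_iff split: split_indicator)
  ultimately show ?thesis
    by simp
qed

lemma H_equal_sin_one_period:
  assumes n: "1 \<le> n" and m: "1 \<le> m"
  shows "H_equal n m sin (\<lambda>t. sin t * indicator {0..2 * pi} t)"
  unfolding H_equal_def using eventually_gt_at_top[of 0]
proof eventually_elim
  case (elim l)
  have "exp (- of_real l * of_real (2 * pi)) = complex_of_real (exp (- l * (2 * pi)))"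
    by (simp flip: exp_of_real)
  moreover have "exp (- l * (2 * pi)) \<noteq> 1"
    using elim by simp
  ultimately have "1 - exp (- of_real l * of_real (2 * pi)) \<noteq> (0 :: complex)"
    by (metis eq_iff_diff_eq_0 of_real_eq_1_iff)
  then show ?case
    unfolding H_def laplace_sin_one_period_power[OF elim n] laplace_sin_one_period_power[OF elim m]
    using laplace_sin_power_nonzero[OF elim, of m] by simp
qed

section \<open>Membership in the class\<close>

lemma cadlag_if_continuous:
  assumes "continuous_on UNIV p"
  shows "cadlag p"
  unfolding cadlag_def
proof (intro conjI allI impI)
  fix t
  have "isCont p t"
    using assms continuous_on_eq_continuous_at[OF open_UNIV] by blast
  then show "continuous (at_right t) p"
    by (rule continuous_at_imp_continuous_at_within)
  from \<open>isCont p t\<close> have "(p \<longlongrightarrow> p t) (at_left t)"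
    unfolding isCont_def by (rule filterlim_at_split[THEN iffD1, THEN conjunct1])
  then show "\<exists>l. (p \<longlongrightarrow> l) (at_left t)"
    by blast
qed

lemma exponential_order_if_bounded:
  assumes "\<And>x. \<bar>p x\<bar> \<le> 1"
  shows "exponential_order p"
  unfolding exponential_order_def
proof (rule exI[of _ 1], intro conjI exI[of _ 1] allI impI)
  fix x :: real assume "0 \<le> x"
  then have "1 \<le> exp (1 * x)" by simp
  then show "\<bar>p x\<bar> \<le> 1 * exp (1 * x)" using assms[of x] by linarith
qed auto

lemma inf_support_eq_0:
  assumes T: "0 < T" and p: "\<And>x. 0 < x \<Longrightarrow> x < T \<Longrightarrow> p x \<noteq> 0"
  shows "inf_support p = 0"
  unfolding inf_support_def
proof (rule antisym)
  show "Inf (ereal ` {x. 0 < x \<and> p x \<noteq> 0}) \<le> 0"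
  proof (rule dense_ge)
    fix y :: ereal assume "0 < y"
    then obtain z where z: "0 < ereal z" "ereal z < y"
      using ereal_dense2 by blast
    define x where "x = min z (T / 2)"
    have "0 < x" "x < T" "x \<le> z" using z T by (auto simp: x_def)
    then have "Inf (ereal ` {x. 0 < x \<and> p x \<noteq> 0}) \<le> ereal x"
      using p by (intro Inf_lower) auto
    also have "\<dots> \<le> y" using \<open>x \<le> z\<close> z by (meson ereal_less_eq(3) less_imp_le order_trans)
    finally show "Inf (ereal ` {x. 0 < x \<and> p x \<noteq> 0}) \<le> y" .
  qed
  show "0 \<le> Inf (ereal ` {x. 0 < x \<and> p x \<noteq> 0})"
    by (intro Inf_greatest) auto
qed

lemma sin_in_cadlag_class: "sin \<in> cadlag_class"
  unfolding cadlag_class_def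
  by (auto intro!: cadlag_if_continuous exponential_order_if_bounded inf_support_eq_0[of pi]
      continuous_on_sin continuous_on_id dest: sin_gt_zero)

lemma sin_one_period_in_cadlag_class: "(\<lambda>t. sin t * indicator {0..2 * pi} t) \<in> cadlag_class"
proof -
  \<comment> \<open>Cutting off creates no jump, because the sine vanishes at both cut points.\<close>
  have clamp: "(\<lambda>t::real. sin t * indicator {0..2 * pi} t) = (\<lambda>t. sin (max 0 (min t (2 * pi))))"
    by (auto simp: fun_eq_iff max_def min_def split: split_indicator)
  have "continuous_on UNIV (\<lambda>t::real. sin (max 0 (min t (2 * pi))))"
    by (intro continuous_intros)
  then have "continuous_on UNIV (\<lambda>t::real. sin t * indicator {0..2 * pi} t)"
    by (simp only: clamp)
  moreover have "sin t * indicator {0..2 * pi} t \<noteq> 0" if "0 < t" "t < pi" for t :: real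
    using sin_gt_zero[OF that] that by auto
  ultimately show ?thesis
    unfolding cadlag_class_def
    by (auto intro!: cadlag_if_continuous exponential_order_if_bounded inf_support_eq_0[of pi]
        split: split_indicator)
qed

lemma sin_neq_sin_one_period:
  "\<exists>t\<ge>0. sin t \<noteq> sin t * indicator {0..2 * pi} (t::real)"
proof (intro exI conjI)
  have "sin (pi / 2 + 2 * pi) = 1"
    by (simp only: sin_periodic sin_pi_half)
  moreover have "pi / 2 + 2 * pi \<notin> {0..2 * pi}"
    by simp
  ultimately show "sin (pi / 2 + 2 * pi) \<noteq>
      sin (pi / 2 + 2 * pi) * indicator {0..2 * pi} (pi / 2 + 2 * pi)"
    by simp
qed simp

theorem mainTheorem3:
  shows "\<not> (\<forall>n m :: nat. 1 \<le> n \<longrightarrow> 1 \<le> m \<longrightarrow> n \<noteq> m \<longrightarrow>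
            (\<forall>p\<in>cadlag_class. identified_by_ratio cadlag_class n m p))
    \<and> (\<forall>n m :: nat. coprime n m \<longrightarrow> m < n \<longrightarrow> 1 \<le> m \<longrightarrow>
        (let p = (\<lambda>t::real. sin t);
             q = (\<lambda>t::real. sin t * indicator {0..2 * pi} t)
         in cadlag p \<and> exponential_order p \<and> inf_support p = 0 \<and>
            cadlag q \<and> exponential_order q \<and> inf_support q = 0 \<and>
            (\<exists>t\<ge>0. p t \<noteq> q t) \<and>
            H_equal n m p q))"
proof (intro conjI allI impI)
  have "H_equal 2 1 sin (\<lambda>t. sin t * indicator {0..2 * pi} t)"
    by (rule H_equal_sin_one_period) auto
  then have "\<not> identified_by_ratio cadlag_class 2 1 sin"
    unfolding identified_by_ratio_def
    using sin_one_period_in_cadlag_class sin_neq_sin_one_period by blast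
  moreover have "1 \<le> (2::nat)" "1 \<le> (1::nat)" "(2::nat) \<noteq> 1"
    by auto
  ultimately show "\<not> (\<forall>n m :: nat. 1 \<le> n \<longrightarrow> 1 \<le> m \<longrightarrow> n \<noteq> m \<longrightarrow>
      (\<forall>p\<in>cadlag_class. identified_by_ratio cadlag_class n m p))"
    using sin_in_cadlag_class by blast
next
  fix n m :: nat
  assume "m < n" "1 \<le> m"
  then have "H_equal n m sin (\<lambda>t. sin t * indicator {0..2 * pi} t)"
    by (intro H_equal_sin_one_period) auto
  then show "let p = (\<lambda>t::real. sin t);
             q = (\<lambda>t::real. sin t * indicator {0..2 * pi} t)
         in cadlag p \<and> exponential_order p \<and> inf_support p = 0 \<and>
            cadlag q \<and> exponential_order q \<and> inf_support q = 0 \<and>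
            (\<exists>t\<ge>0. p t \<noteq> q t) \<and>
            H_equal n m p q"
    using sin_in_cadlag_class sin_one_period_in_cadlag_class sin_neq_sin_one_period
    by (simp add: cadlag_class_def Let_def)
qed

end
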